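(* The poset $(\tilde W\cup\tilde{\mathcal W},\le)$ is a meet semi-lattice.
   Context: $\tilde W$ is the affine symmetric group (affine Weyl group of type $\tilde A_{n-1}$) with simple generators $s_i$ and simple roots $\alpha_i$, $i\in\mathbb Z/n\mathbb Z$. For $w\in\tilde W$ with reduced word $i_1\cdots i_k$, define $\mathrm{Inv}(w)=\{\alpha_{i_1},s_{i_1}\alpha_{i_2},\dots,s_{i_1}\cdots s_{i_{k-1}}\alpha_{i_k}\}$. An infinite word $\mathbf i=i_1i_2\cdots$ in $\mathbb Z/n\mathbb Z$ is reduced if each prefix $s_{i_1}\cdots s_{i_k}$ has length $k$. Set $\mathrm{Inv}(\mathbf i)=\bigcup_k\mathrm{Inv}(s_{i_1}\cdots s_{i_k})$. Two infinite reduced words are braid-equivalent if they have the same inversion set. The equivalence class $[\mathbf i]$ is called a limit element, and $\tilde{\mathcal W}$ denotes the set of limit elements. The partial order $\le$ on $\tilde W\cup\tilde{\mathcal W}$ is inclusion of inversion sets. Restricted to $\tilde W$ this is the usual (right) weak order. On $\tilde{\mathcal W}$ it is the limit weak order $[\mathbf i]\le[\mathbf j]\iff\mathrm{Inv}(\mathbf i)\subseteq\mathrm{Inv}(\mathbf j)$. *)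

theory Defs
  imports "HOL-Algebra.Lattice"
begin

text \<open>
  The index set \<open>\<int>/n\<int>\<close> is \<open>{..<n}\<close>. The Weyl group
  of affine type \<open>A\<close> with \<open>n \<ge> 2\<close> simple generators (the affine symmetric group) is
  realised by its faithful action on the root lattice, which is free on the simple roots
  \<open>\<alpha>\<^sub>i\<close>. A vector is its coefficient function; coefficients at indices \<open>j \<ge> n\<close> are never read
  or changed by the simple reflections with index below \<open>n\<close>.
\<close>

type_synonym lattice_vec = "nat \<Rightarrow> int"

text \<open>
  The entry \<open>\<langle>\<alpha>\<^sub>j, \<alpha>\<^sub>i\<^sup>\<or>\<rangle>\<close> of the generalised Cartan matrix. The last two summands coincide for
  \<open>n = 2\<close>, which gives the off-diagonal entries \<open>-2\<close> of affine type \<open>A\<^sub>1\<close>.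
\<close>

definition cartan :: "nat \<Rightarrow> nat \<Rightarrow> nat \<Rightarrow> int" where
  "cartan n i j = 2 * of_bool (i = j) - of_bool (j = Suc i mod n) - of_bool (i = Suc j mod n)"

definition simple_root :: "nat \<Rightarrow> lattice_vec" where
  "simple_root i = (\<lambda>j. of_bool (j = i))"

definition simple_refl :: "nat \<Rightarrow> nat \<Rightarrow> lattice_vec \<Rightarrow> lattice_vec" where
  "simple_refl n i v = (\<lambda>k. v k - (\<Sum>j<n. cartan n i j * v j) * simple_root i k)"

text \<open>\<open>word_prod n [i\<^sub>1, \<dots>, i\<^sub>k]\<close> is \<open>s\<^bsub>i\<^sub>1\<^esub> \<cdots> s\<^bsub>i\<^sub>k\<^esub>\<close>, the rightmost factor acting first.\<close>

definition word_prod :: "nat \<Rightarrow> nat list \<Rightarrow> lattice_vec \<Rightarrow> lattice_vec" where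
  "word_prod n is = foldr (\<lambda>i f. simple_refl n i \<circ> f) is id"

text \<open>
  Since the simple reflections are involutions (see below), the products of words form the
  group that they generate.
\<close>

definition affine_weyl :: "nat \<Rightarrow> (lattice_vec \<Rightarrow> lattice_vec) set" where
  "affine_weyl n = word_prod n ` lists {..<n}"

lemma simple_refl_involution:
  assumes "2 \<le> n" "i < n"
  shows "simple_refl n i \<circ> simple_refl n i = id"
proof -
  have ne: "i \<noteq> Suc i mod n"
    using assms by (cases "Suc i = n") auto
  define c where "c = (\<lambda>v. \<Sum>j<n. cartan n i j * v j)"
  have refl: "simple_refl n i v = (\<lambda>k. v k - c v * simple_root i k)" for v
    by (simp add: simple_refl_def c_def)
  have "cartan n i j * simple_root i j = (if j = i then 2 else 0)" for j
    using ne by (simp add: cartan_def simple_root_def)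
  then have root: "c (simple_root i) = 2"
    using assms by (simp add: c_def)
  have "c (\<lambda>k. v k - d * simple_root i k) = c v - d * c (simple_root i)" for v d
    by (simp add: c_def right_diff_distrib sum_subtractf sum_distrib_left mult.left_commute)
  then have "c (\<lambda>k. v k - c v * simple_root i k) = - c v" for v
    by (simp add: root)
  then show ?thesis
    by (intro ext) (simp add: refl)
qed

definition weyl_length :: "nat \<Rightarrow> (lattice_vec \<Rightarrow> lattice_vec) \<Rightarrow> nat" where
  "weyl_length n w = (LEAST k. \<exists>is \<in> lists {..<n}. word_prod n is = w \<and> length is = k)"

definition reduced_word :: "nat \<Rightarrow> (lattice_vec \<Rightarrow> lattice_vec) \<Rightarrow> nat list \<Rightarrow> bool" where
  "reduced_word n w is \<longleftrightarrow>
     is \<in> lists {..<n} \<and> word_prod n is = w \<and> length is = weyl_length n w"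

definition word_inversions :: "nat \<Rightarrow> nat list \<Rightarrow> lattice_vec set" where
  "word_inversions n is = (\<lambda>k. word_prod n (take k is) (simple_root (is ! k))) ` {..<length is}"

text \<open>The inversion set does not depend on the choice of the reduced word.\<close>

definition Inv :: "nat \<Rightarrow> (lattice_vec \<Rightarrow> lattice_vec) \<Rightarrow> lattice_vec set" where
  "Inv n w = word_inversions n (SOME is. reduced_word n w is)"

text \<open>Infinite words are indexed from \<open>0\<close>; the prefix of length \<open>k\<close> is \<open>map i [0..<k]\<close>.\<close>

definition reduced_infinite_words :: "nat \<Rightarrow> (nat \<Rightarrow> nat) set" where
  "reduced_infinite_words n =
     {i. range i \<subseteq> {..<n} \<and> (\<forall>k. weyl_length n (word_prod n (map i [0..<k])) = k)}"

definition Inv_infinite :: "nat \<Rightarrow> (nat \<Rightarrow> nat) \<Rightarrow> lattice_vec set" where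
  "Inv_infinite n i = (\<Union>k. Inv n (word_prod n (map i [0..<k])))"

definition braid_equiv :: "nat \<Rightarrow> ((nat \<Rightarrow> nat) \<times> (nat \<Rightarrow> nat)) set" where
  "braid_equiv n = {(i, j). i \<in> reduced_infinite_words n \<and> j \<in> reduced_infinite_words n
                            \<and> Inv_infinite n i = Inv_infinite n j}"

definition limit_elements :: "nat \<Rightarrow> (nat \<Rightarrow> nat) set set" where
  "limit_elements n = reduced_infinite_words n // braid_equiv n"

type_synonym weyl_or_limit = "(lattice_vec \<Rightarrow> lattice_vec) + (nat \<Rightarrow> nat) set"

text \<open>For a limit element, all members of the union are equal.\<close>

fun inversion_set :: "nat \<Rightarrow> weyl_or_limit \<Rightarrow> lattice_vec set" where
  "inversion_set n (Inl w) = Inv n w"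
| "inversion_set n (Inr c) = (\<Union>i\<in>c. Inv_infinite n i)"

definition limit_weak_order :: "nat \<Rightarrow> weyl_or_limit gorder" where
  "limit_weak_order n =
     \<lparr>carrier = affine_weyl n <+> limit_elements n,
      eq = (=),
      le = (\<lambda>x y. inversion_set n x \<subseteq> inversion_set n y)\<rparr>"

end

theory Submission
  imports Defs
begin

text \<open>
  The real roots are the vectors \<open>aff_root n a b\<close> (written \<open>e\<^sub>a - e\<^sub>b\<close> in the usual notation), with
  integers \<open>a\<close>, \<open>b\<close> incongruent modulo \<open>n\<close>, positive when \<open>a < b\<close>. A simple reflection acts on them
  through a permutation of \<open>\<int>\<close> that commutes with the translation by \<open>n\<close>, so an inversion set
  becomes a set of pairs \<open>a < b\<close>. A finite set of positive roots is an inversion set as soon as both it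
  and its complement are closed under \<open>(a, b), (b, c) \<mapsto> (a, c)\<close>: peel off a simple root that it
  contains. For the meet of two group elements, the complement of the inversion set is the transitive
  closure of the union of the two complements. Each inversion set in the limit order is the union of an
  increasing sequence of inversion sets of group elements; the termwise meets of two such sequences
  increase, and their union either stabilises or is the inversion set of an infinite reduced word.
\<close>

section \<open>Roots as pairs of integers, reflections as permutations\<close>

text \<open>
  The formula is a solution of \<open>weight n (c + 1) - weight n c = \<alpha>\<^bsub>c mod n\<^esub>\<close>, so that
  \<open>aff_root n a b\<close> below is \<open>\<alpha>\<^sub>a + \<dots> + \<alpha>\<^bsub>b-1\<^esub>\<close> for \<open>a < b\<close>, with indices modulo \<open>n\<close>.
\<close>

definition weight :: "nat \<Rightarrow> int \<Rightarrow> lattice_vec" where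
  "weight n c = (\<lambda>k. if k < n then (c + int n - 1 - int k) div int n else 0)"

definition aff_root :: "nat \<Rightarrow> int \<Rightarrow> int \<Rightarrow> lattice_vec" where
  "aff_root n a b = (\<lambda>k. weight n b k - weight n a k)"

text \<open>\<open>simple_refl n i\<close> corresponds to the permutation of the integers that swaps
  \<open>c\<close> and \<open>c + 1\<close> for every \<open>c\<close> congruent to \<open>i\<close>
  modulo \<open>n\<close>; this is the amount by which \<open>c\<close> moves.\<close>

definition displacement :: "nat \<Rightarrow> nat \<Rightarrow> int \<Rightarrow> int" where
  "displacement n i c = of_bool (c mod int n = int i) - of_bool ((c - 1) mod int n = int i)"

definition aff_transp :: "nat \<Rightarrow> nat \<Rightarrow> int \<Rightarrow> int" where
  "aff_transp n i c = c + displacement n i c"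

definition aff_perm :: "nat \<Rightarrow> nat list \<Rightarrow> int \<Rightarrow> int" where
  "aff_perm n is = foldr (\<lambda>i f. aff_transp n i \<circ> f) is id"

definition pos_roots :: "nat \<Rightarrow> lattice_vec set" where
  "pos_roots n = {aff_root n a b | a b. a < b}"

definition neg_roots :: "nat \<Rightarrow> lattice_vec set" where
  "neg_roots n = {aff_root n a b | a b. b < a}"

text \<open>A substitute for \<open>word_inversions\<close> that depends only on the product and
  makes sense for words that are not reduced.\<close>

definition inversions :: "nat \<Rightarrow> nat list \<Rightarrow> lattice_vec set" where
  "inversions n is = word_prod n is ` neg_roots n \<inter> pos_roots n"

definition root_closed :: "nat \<Rightarrow> lattice_vec set \<Rightarrow> bool" where
  "root_closed n A \<longleftrightarrow>
     (\<forall>a b c. a < b \<longrightarrow> b < c \<longrightarrow> aff_root n a b \<in> A \<longrightarrow> aff_root n b c \<in> A \<longrightarrow> aff_root n a c \<in> A)"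

definition root_coclosed :: "nat \<Rightarrow> lattice_vec set \<Rightarrow> bool" where
  "root_coclosed n A \<longleftrightarrow>
     (\<forall>a b c. a < b \<longrightarrow> b < c \<longrightarrow> aff_root n a c \<in> A \<longrightarrow> aff_root n a b \<in> A \<or> aff_root n b c \<in> A)"

lemma word_prod_Nil [simp]: "word_prod n [] = id"
  and word_prod_Cons [simp]: "word_prod n (i # is) = simple_refl n i \<circ> word_prod n is"
  by (simp_all add: word_prod_def)

lemma aff_perm_Nil [simp]: "aff_perm n [] = id"
  and aff_perm_Cons [simp]: "aff_perm n (i # is) = aff_transp n i \<circ> aff_perm n is"
  by (simp_all add: aff_perm_def)

lemma word_prod_append: "word_prod n (xs @ ys) = word_prod n xs \<circ> word_prod n ys"
  by (induction xs) (simp_all add: comp_assoc)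

lemma aff_perm_append: "aff_perm n (xs @ ys) = aff_perm n xs \<circ> aff_perm n ys"
  by (induction xs) (simp_all add: comp_assoc)

lemma succ_div_int:
  fixes x m :: int
  assumes "0 < m"
  shows "(x + 1) div m = x div m + of_bool (m dvd x + 1)"
proof (cases "m dvd x + 1")
  case True
  then obtain q where q: "x + 1 = m * q" by (elim dvdE)
  then have "x div m = q - 1"
    using assms by (intro int_div_pos_eq[where r = "m - 1"]) (auto simp: algebra_simps)
  then show ?thesis using q assms by simp
next
  case False
  have "x mod m + 1 \<noteq> m"
  proof
    assume "x mod m + 1 = m"
    then have "x + 1 = m * (x div m + 1)"
      using mult_div_mod_eq[of m x] by (simp only: distrib_left mult_1_right)
    with False show False by simp
  qed
  then have lt: "x mod m + 1 < m" using pos_mod_bound[OF assms, of x] by simp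
  have "(x + 1) div m = x div m"
    using assms lt
    by (intro int_div_pos_eq[where r = "x mod m + 1"]) (use mult_div_mod_eq[of m x] in \<open>auto simp: algebra_simps\<close>)
  then show ?thesis using False by simp
qed

text \<open>An identity for \<open>aff_root n a b\<close> says that some quantity takes equal values
  at both endpoints, so this reduces it to the step from \<open>c\<close> to
  \<open>c + 1\<close>.\<close>

lemma int_fun_const:
  fixes f :: "int \<Rightarrow> 'a"
  assumes "\<And>c. f (c + 1) = f c"
  shows "f a = f b"
proof -
  have "f c = f 0" for c
  proof (induction c rule: int_induct[where k = 0])
    case (step2 i)
    then show ?case using assms[of "i - 1"] by simp
  qed (simp_all add: assms)
  then show ?thesis by metis
qed

lemma mod_eq_imp_translate:
  fixes a b m :: int
  assumes "a mod m = b mod m"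
  shows "\<exists>k. a = b + m * k"
proof -
  have "m dvd a - b" using assms by (simp add: mod_eq_dvd_iff)
  then obtain k where "a - b = m * k" by (elim dvdE)
  then show ?thesis by (intro exI[of _ k]) simp
qed

section \<open>Heights, endpoints and pairings of roots\<close>

context
  fixes n :: nat
  assumes n2: "2 \<le> n"
begin

lemma aff_root_succ: "aff_root n c (c + 1) = simple_root (nat (c mod int n))"
proof
  fix k
  show "aff_root n c (c + 1) k = simple_root (nat (c mod int n)) k"
  proof (cases "k < n")
    case True
    have "(c + 1 + int n - 1 - int k) div int n
        = (c + int n - 1 - int k) div int n + of_bool (int n dvd c + int n - int k)"
      using succ_div_int[of "int n" "c + int n - 1 - int k"] n2 by (simp add: algebra_simps)
    moreover have "int n dvd c + int n - int k \<longleftrightarrow> c mod int n = int k"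
    proof -
      have "int n dvd c + int n - int k \<longleftrightarrow> int n dvd c - int k"
        by (metis add_diff_eq diff_add_eq dvd_add_triv_right_iff)
      also have "\<dots> \<longleftrightarrow> c mod int n = int k mod int n"
        by (simp add: mod_eq_dvd_iff)
      finally show ?thesis using True by simp
    qed
    moreover have "c mod int n \<ge> 0" using n2 by simp
    ultimately show ?thesis
      using True by (auto simp: aff_root_def weight_def simple_root_def)
  next
    case False
    have "nat (c mod int n) < n"
      using n2 by (simp add: nat_less_iff)
    then show ?thesis using False by (auto simp: aff_root_def weight_def simple_root_def)
  qed
qed

lemma simple_root_eq: "i < n \<Longrightarrow> simple_root i = aff_root n (int i) (int i + 1)"
  by (simp add: aff_root_succ)

lemma weight_succ: "weight n (c + 1) k = weight n c k + simple_root (nat (c mod int n)) k"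
  using fun_cong[OF aff_root_succ, of c k] by (simp add: aff_root_def)

text \<open>Each unit step adds one simple root. The height separates positive from negative
  roots.\<close>

lemma height_aff_root: "(\<Sum>k<n. aff_root n a b k) = b - a"
proof -
  let ?h = "\<lambda>c. (\<Sum>k<n. weight n c k) - c"
  have "(\<Sum>k<n. simple_root (nat (c mod int n)) k) = 1" for c
  proof -
    have "nat (c mod int n) < n" using n2 by (simp add: nat_less_iff)
    then show ?thesis by (simp add: simple_root_def)
  qed
  then have "?h (c + 1) = ?h c" for c
    by (simp add: weight_succ sum.distrib)
  then have "?h a = ?h b" by (rule int_fun_const)
  then show ?thesis by (simp add: aff_root_def sum_subtractf)
qed

lemma aff_root_height_eq: "aff_root n a b = aff_root n c d \<Longrightarrow> b - a = d - c"
  by (metis height_aff_root)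

lemma weight_translate: "k < n \<Longrightarrow> weight n (c + int n * m) k = weight n c k + m"
proof -
  assume "k < n"
  have "(c + int n * m + int n - 1 - int k) = (c + int n - 1 - int k) + int n * m" by simp
  then have "(c + int n * m + int n - 1 - int k) div int n = (c + int n - 1 - int k) div int n + m"
    using n2 by (simp only:) simp
  then show ?thesis using \<open>k < n\<close> by (simp add: weight_def)
qed

lemma aff_root_translate: "aff_root n (a + int n * m) (b + int n * m) = aff_root n a b"
proof
  fix k
  show "aff_root n (a + int n * m) (b + int n * m) k = aff_root n a b k"
    by (cases "k < n") (simp_all add: aff_root_def weight_translate, simp add: weight_def)
qed

text \<open>The cyclic differences of the coefficients of \<open>aff_root n a b\<close> recover the residues of \<open>a\<close>, \<open>b\<close>.\<close>

lemma weight_cyclic_diff: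
  assumes "k < n"
  shows "weight n c (if k = 0 then n - 1 else k - 1) - weight n c k
           = of_bool (c mod int n = int k) - of_bool (k = 0)"
proof (cases "k = 0")
  case True
  have "(c + int n - 1) div int n = (c - 1) div int n + 1"
    using n2 div_add_self2[of "int n" "c - 1"] by (simp add: algebra_simps)
  moreover have "c div int n = (c - 1) div int n + of_bool (int n dvd c)"
    using succ_div_int[of "int n" "c - 1"] n2 by simp
  moreover have "c + int n - 1 - int (n - 1) = c" using n2 by (simp add: of_nat_diff)
  ultimately show ?thesis using True n2 by (simp add: weight_def dvd_eq_mod_eq_0)
next
  case False
  have "int n dvd c + int n - int k \<longleftrightarrow> int n dvd c - int k"
    by (metis add_diff_eq diff_add_eq dvd_add_triv_right_iff)
  also have "\<dots> \<longleftrightarrow> c mod int n = int k"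
    using assms by (simp flip: mod_eq_dvd_iff)
  finally have dvd: "int n dvd c + int n - int k \<longleftrightarrow> c mod int n = int k" .
  have "(c + int n - 1 - int (k - 1)) div int n
      = (c + int n - 1 - int k) div int n + of_bool (int n dvd c + int n - int k)"
    using succ_div_int[of "int n" "c + int n - 1 - int k"] n2 False
    by (simp add: algebra_simps of_nat_diff)
  then show ?thesis using False assms dvd by (simp add: weight_def less_imp_diff_less)
qed

text \<open>The cyclic differences give the residues and the height gives the distance. With
  congruent endpoints the vector is a multiple of the imaginary root and remembers only
  \<open>b - a\<close>.\<close>

lemma aff_root_eqD:
  assumes eq: "aff_root n a b = aff_root n c d" and ne: "a mod int n \<noteq> b mod int n"
  shows "\<exists>m. c = a + int n * m \<and> d = b + int n * m"
proof -
  have res: "of_bool (b mod int n = int k) - of_bool (a mod int n = int k)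
      = (of_bool (d mod int n = int k) - of_bool (c mod int n = int k) :: int)" if "k < n" for k
  proof -
    let ?j = "if k = 0 then n - 1 else k - 1"
    have "aff_root n a b ?j - aff_root n a b k = aff_root n c d ?j - aff_root n c d k"
      by (simp add: eq)
    then show ?thesis
      using weight_cyclic_diff[OF that, of a] weight_cyclic_diff[OF that, of b]
        weight_cyclic_diff[OF that, of c] weight_cyclic_diff[OF that, of d]
      by (simp add: aff_root_def)
  qed
  have "nat (a mod int n) < n" using n2 by (simp add: nat_less_iff)
  \<comment> \<open>At the index of the residue of \<open>a\<close> the left side is -1, since
    \<open>b\<close> has another residue; on the right only the residue of \<open>c\<close> can
    produce -1.\<close>
  from res[OF this] have "c mod int n = a mod int n"
    using n2 ne by (simp split: if_splits add: of_bool_def)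
  then obtain m where m: "c = a + int n * m" using mod_eq_imp_translate by blast
  with aff_root_height_eq[OF eq] show ?thesis by auto
qed

lemma pairing_simple_root:
  "j < n \<Longrightarrow> (\<Sum>k<n. cartan n i k * simple_root j k) = cartan n i j"
  by (simp add: simple_root_def of_bool_def if_distrib cong: if_cong)

text \<open>This is the pairing with \<open>aff_root n c (c + 1)\<close>, the unit step behind
  \<open>pairing_aff_root\<close>. For \<open>n = 2\<close> the two neighbours of \<open>i\<close>
  coincide and both sides give -2.\<close>

lemma cartan_mod:
  assumes "i < n"
  shows "cartan n i (nat (c mod int n)) = displacement n i c - displacement n i (c + 1)"
proof -
  have "nat (c mod int n) = Suc i mod n \<longleftrightarrow> (c - 1) mod int n = int i"
  proof -
    have "nat (c mod int n) = Suc i mod n \<longleftrightarrow> c mod int n = (int i + 1) mod int n"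
      using n2 by (simp add: nat_eq_iff zmod_int add.commute)
    also have "\<dots> \<longleftrightarrow> (c - 1) mod int n = int i mod int n"
      by (simp add: mod_eq_dvd_iff algebra_simps)
    finally show ?thesis using assms by simp
  qed
  moreover have "i = Suc (nat (c mod int n)) mod n \<longleftrightarrow> (c + 1) mod int n = int i"
  proof -
    have "int (Suc (nat (c mod int n)) mod n) = (c + 1) mod int n"
      using n2 by (simp add: zmod_int mod_simps add.commute)
    then show ?thesis by linarith
  qed
  moreover have "i = nat (c mod int n) \<longleftrightarrow> c mod int n = int i"
    using n2 by auto
  ultimately show ?thesis by (simp add: cartan_def displacement_def)
qed

lemma pairing_aff_root:
  assumes "i < n"
  shows "(\<Sum>k<n. cartan n i k * aff_root n a b k) = displacement n i a - displacement n i b"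
proof -
  let ?h = "\<lambda>c. (\<Sum>k<n. cartan n i k * weight n c k) + displacement n i c"
  have "?h (c + 1) = ?h c" for c
  proof -
    have "nat (c mod int n) < n" using n2 by (simp add: nat_less_iff)
    then show ?thesis
      using cartan_mod[OF assms, of c]
      by (simp add: weight_succ distrib_left sum.distrib pairing_simple_root)
  qed
  then have "?h a = ?h b" by (rule int_fun_const)
  then show ?thesis by (simp add: aff_root_def sum_subtractf right_diff_distrib)
qed

lemma pred_mod_neq: "c mod int n = int i \<Longrightarrow> (c - 1) mod int n \<noteq> int i"
proof
  assume "c mod int n = int i" "(c - 1) mod int n = int i"
  then have "int n dvd c - (c - 1)" by (metis mod_eq_dvd_iff)
  then show False using n2 by simp
qed

lemma weight_transp: "weight n (aff_transp n i c) k = weight n c k + displacement n i c * simple_root i k"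
  using weight_succ[of c k] weight_succ[of "c - 1" k] pred_mod_neq[of c i]
  by (auto simp: aff_transp_def displacement_def)

text \<open>The bridge from vectors to integers: the pairing is a difference of displacements, and
  moving an endpoint by its displacement changes its weight by that multiple of the simple
  root.\<close>

lemma simple_refl_aff_root:
  "i < n \<Longrightarrow> simple_refl n i (aff_root n a b) = aff_root n (aff_transp n i a) (aff_transp n i b)"
  by (simp add: simple_refl_def pairing_aff_root)
    (simp add: aff_root_def weight_transp algebra_simps)

lemma displacement_cases:
  "displacement n i c = 1 \<and> c mod int n = int i \<or>
   displacement n i c = -1 \<and> (c - 1) mod int n = int i \<or>
   displacement n i c = 0 \<and> c mod int n \<noteq> int i \<and> (c - 1) mod int n \<noteq> int i"
  using pred_mod_neq[of c i] by (auto simp: displacement_def)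

lemma aff_transp_involution [simp]: "aff_transp n i (aff_transp n i c) = c"
  using pred_mod_neq[of c i] pred_mod_neq[of "c + 1" i] pred_mod_neq[of "c - 1" i]
  by (auto simp: aff_transp_def displacement_def)

lemma aff_transp_eq_iff [simp]: "aff_transp n i a = aff_transp n i b \<longleftrightarrow> a = b"
  by (metis aff_transp_involution)

text \<open>Each endpoint moves by at most one, so only distances 1 and 2 matter. At distance 2 the
  endpoints would have to meet, which makes \<open>n\<close> divide 1. Thus a simple reflection
  makes only its own simple root negative.\<close>

lemma aff_transp_reverses:
  assumes "i < n" "a < b" "\<not> aff_transp n i a < aff_transp n i b"
  shows "aff_root n a b = simple_root i"
proof -
  have "b = a + 1 \<and> a mod int n = int i"
  proof (cases "b = a + 1")
    case True
    then show ?thesis using assms displacement_cases[of i a] displacement_cases[of i b]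
      by (auto simp: aff_transp_def)
  next
    case False
    then have "b - a = 2" "a mod int n = int i" "(b - 1) mod int n = int i"
      using assms displacement_cases[of i a] displacement_cases[of i b]
      by (auto simp: aff_transp_def)
    then have "int n dvd (b - 1) - a" by (metis mod_eq_dvd_iff)
    moreover have "(b - 1) - a = 1" using \<open>b - a = 2\<close> by simp
    ultimately show ?thesis using n2 by simp
  qed
  then show ?thesis by (simp add: aff_root_succ)
qed

section \<open>Words as permutations, and their inversions\<close>

lemma aff_transp_translate: "aff_transp n i (c + int n * m) = aff_transp n i c + int n * m"
proof -
  have "(c + int n * m - 1) mod int n = (c - 1) mod int n"
    by (metis add_diff_eq diff_add_eq mod_mult_self2)
  then show ?thesis by (simp add: aff_transp_def displacement_def)
qed

lemma aff_perm_translate: "aff_perm n is (c + int n * m) = aff_perm n is c + int n * m"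
  by (induction "is") (simp_all add: aff_transp_translate)

lemma aff_perm_rev [simp]: "aff_perm n (rev is) (aff_perm n is c) = c"
  by (induction "is" arbitrary: c) (simp_all add: aff_perm_append)

lemma aff_perm_rev' [simp]: "aff_perm n is (aff_perm n (rev is) c) = c"
  using aff_perm_rev[of "rev is" c] by simp

lemma aff_perm_eq_iff [simp]: "aff_perm n is a = aff_perm n is b \<longleftrightarrow> a = b"
  by (metis aff_perm_rev)

lemma simple_refl_involution' [simp]: "i < n \<Longrightarrow> simple_refl n i (simple_refl n i v) = v"
  using simple_refl_involution[OF n2, of i] by (simp add: fun_eq_iff)

lemma word_prod_aff_root:
  "is \<in> lists {..<n} \<Longrightarrow> word_prod n is (aff_root n a b) = aff_root n (aff_perm n is a) (aff_perm n is b)"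
  by (induction "is") (auto simp: simple_refl_aff_root)

lemma rev_in_lists: "is \<in> lists A \<Longrightarrow> rev is \<in> lists A"
  by (simp add: in_lists_conv_set)

lemma word_prod_rev: "is \<in> lists {..<n} \<Longrightarrow> word_prod n is (word_prod n (rev is) v) = v"
  by (induction "is" arbitrary: v) (auto simp: word_prod_append)

lemma word_prod_rev': "is \<in> lists {..<n} \<Longrightarrow> word_prod n (rev is) (word_prod n is v) = v"
  using word_prod_rev[of "rev is" v] by (simp add: rev_in_lists)

lemma aff_root_pos_iff [simp]: "aff_root n a b \<in> pos_roots n \<longleftrightarrow> a < b"
  by (auto simp: pos_roots_def dest: aff_root_height_eq)

lemma aff_root_neg_iff [simp]: "aff_root n a b \<in> neg_roots n \<longleftrightarrow> b < a"
  by (auto simp: neg_roots_def dest: aff_root_height_eq)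

lemma word_prod_in_image_iff:
  "is \<in> lists {..<n} \<Longrightarrow> v \<in> word_prod n is ` A \<longleftrightarrow> word_prod n (rev is) v \<in> A"
  by (metis (no_types, lifting) image_iff word_prod_rev word_prod_rev')

text \<open>Reversing a word inverts its product and its permutation. From here on, membership is a
  comparison of integers.\<close>

lemma aff_root_in_inversions:
  "is \<in> lists {..<n} \<Longrightarrow> aff_root n a b \<in> inversions n is
     \<longleftrightarrow> a < b \<and> aff_perm n (rev is) b < aff_perm n (rev is) a"
  by (auto simp: inversions_def word_prod_in_image_iff word_prod_aff_root rev_in_lists)

lemma inversions_pos: "inversions n is \<subseteq> pos_roots n"
  by (simp add: inversions_def)

lemma inversions_closed: "is \<in> lists {..<n} \<Longrightarrow> root_closed n (inversions n is)"
  by (auto simp: root_closed_def aff_root_in_inversions)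

lemma inversions_coclosed: "is \<in> lists {..<n} \<Longrightarrow> root_coclosed n (inversions n is)"
  by (auto simp: root_coclosed_def aff_root_in_inversions)

lemma aff_transp_simple:
  assumes "i < n"
  shows "aff_transp n i (int i) = int i + 1" "aff_transp n i (int i + 1) = int i"
  using assms pred_mod_neq[of "int i" i] pred_mod_neq[of "int i + 1" i]
  by (auto simp: aff_transp_def displacement_def)

lemma simple_refl_in_pos_roots:
  assumes "i < n" "v \<in> pos_roots n" "v \<noteq> simple_root i"
  shows "simple_refl n i v \<in> pos_roots n"
proof -
  obtain a b where ab: "v = aff_root n a b" "a < b" using assms by (auto simp: pos_roots_def)
  then have "aff_transp n i a < aff_transp n i b" using aff_transp_reverses[of i a b] assms by blast
  then show ?thesis using ab assms by (simp add: simple_refl_aff_root)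
qed

lemma simple_refl_simple_root:
  "i < n \<Longrightarrow> simple_refl n i (simple_root i) \<notin> pos_roots n"
  by (simp add: simple_root_eq simple_refl_aff_root aff_transp_simple)

text \<open>Only the simple root of \<open>i\<close> changes sign under the reflection, so its
  membership is toggled while the other positive roots are merely permuted.\<close>

lemma inversions_Cons_iff:
  assumes "is \<in> lists {..<n}" "i < n"
  shows "v \<in> inversions n (i # is) \<longleftrightarrow>
     (if v = simple_root i then simple_root i \<notin> inversions n is
      else v \<in> pos_roots n \<and> simple_refl n i v \<in> inversions n is)"
proof (cases "v = simple_root i")
  case True
  have "simple_root i \<in> inversions n (i # is) \<longleftrightarrow> simple_root i \<notin> inversions n is"
    using assms not_less_iff_gr_or_eq[of "aff_perm n (rev is) (int i)" "aff_perm n (rev is) (int i + 1)"]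
    by (auto simp: simple_root_eq aff_root_in_inversions aff_perm_append aff_transp_simple)
  then show ?thesis using True by simp
next
  case False
  have "v \<in> inversions n (i # is) \<longleftrightarrow> simple_refl n i v \<in> inversions n is" if v: "v \<in> pos_roots n"
  proof -
    obtain a b where ab: "v = aff_root n a b" "a < b" using v by (auto simp: pos_roots_def)
    have "aff_transp n i a < aff_transp n i b"
      using aff_transp_reverses[of i a b] ab False assms by blast
    then show ?thesis
      using assms ab by (simp add: aff_root_in_inversions simple_refl_aff_root aff_perm_append)
  qed
  then show ?thesis using False inversions_pos by auto
qed

lemma in_simple_refl_image_iff: "i < n \<Longrightarrow> v \<in> simple_refl n i ` A \<longleftrightarrow> simple_refl n i v \<in> A"
  by (metis (no_types, lifting) image_iff simple_refl_involution')

lemma inj_simple_refl: "i < n \<Longrightarrow> inj_on (simple_refl n i) A"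
  by (metis inj_onI simple_refl_involution')

lemma inversions_Cons_descent:
  assumes "is \<in> lists {..<n}" "i < n" "simple_root i \<in> inversions n is"
  shows "inversions n (i # is) = simple_refl n i ` (inversions n is - {simple_root i})"
proof (intro Set.set_eqI)
  fix v
  show "v \<in> inversions n (i # is) \<longleftrightarrow> v \<in> simple_refl n i ` (inversions n is - {simple_root i})"
  proof (cases "v = simple_root i")
    case True
    have "simple_refl n i (simple_root i) \<notin> inversions n is"
      using simple_refl_simple_root[OF assms(2)] inversions_pos by blast
    then show ?thesis
      using assms True by (simp add: inversions_Cons_iff in_simple_refl_image_iff del: in_lists_conv_set)
  next
    case False
    have "v \<in> pos_roots n \<longleftrightarrow> simple_refl n i v \<noteq> simple_root i" if "simple_refl n i v \<in> inversions n is"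
    proof -
      have pos: "simple_refl n i v \<in> pos_roots n" using that inversions_pos by blast
      have v: "simple_refl n i (simple_refl n i v) = v" using assms(2) by simp
      show ?thesis
        using simple_refl_in_pos_roots[OF assms(2) pos] simple_refl_simple_root[OF assms(2)] v by metis
    qed
    then show ?thesis
      using assms(1,2) False inversions_Cons_iff[OF assms(1,2), of v] in_simple_refl_image_iff[OF assms(2), of v]
      by (simp del: in_lists_conv_set) blast
  qed
qed

lemma word_inversions_Cons:
  "word_inversions n (i # is) = insert (simple_root i) (simple_refl n i ` word_inversions n is)"
  by (simp add: word_inversions_def lessThan_Suc_eq_insert_0 image_image image_insert)

text \<open>Equality fails for words that are not reduced: \<open>[i, i]\<close> has no inversions,
  but its \<open>word_inversions\<close> contain the simple root and its negative.\<close>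

lemma inversions_subset_word_inversions:
  "is \<in> lists {..<n} \<Longrightarrow> inversions n is \<subseteq> word_inversions n is"
proof (induction "is")
  case Nil
  then show ?case by (auto simp: inversions_def neg_roots_def)
next
  case (Cons i "is")
  then have *: "is \<in> lists {..<n}" "i < n" by auto
  show ?case
  proof
    fix v assume "v \<in> inversions n (i # is)"
    then have "v = simple_root i \<or> simple_refl n i v \<in> word_inversions n is"
      using inversions_Cons_iff[OF *] Cons.IH[OF *(1)] by (auto split: if_splits)
    then show "v \<in> word_inversions n (i # is)"
      using * by (auto simp: word_inversions_Cons in_simple_refl_image_iff)
  qed
qed

lemma finite_word_inversions: "finite (word_inversions n is)"
  by (simp add: word_inversions_def)

lemma card_word_inversions: "card (word_inversions n is) \<le> length is"
  unfolding word_inversions_def using card_image_le[of "{..<length is}"] by simp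

lemma finite_inversions: "is \<in> lists {..<n} \<Longrightarrow> finite (inversions n is)"
  by (meson finite_subset finite_word_inversions inversions_subset_word_inversions)

lemma card_inversions_le: "is \<in> lists {..<n} \<Longrightarrow> card (inversions n is) \<le> length is"
  by (meson card_mono card_word_inversions finite_word_inversions inversions_subset_word_inversions
      le_trans)

text \<open>The inversions form a subset of \<open>word_inversions\<close>, which has no more
  elements than the word has letters; the count leaves no room for others.\<close>

lemma word_inversions_eq:
  assumes "is \<in> lists {..<n}" "length is = card (inversions n is)"
  shows "word_inversions n is = inversions n is"
  using assms card_seteq[OF finite_word_inversions inversions_subset_word_inversions]
    card_word_inversions[of "is"] by metis

section \<open>Biclosed sets of positive roots\<close>

text \<open>Cutting off the last unit step splits a root into a lower one and a simple one. By
  induction on the height, a coclosed set without simple roots is empty.\<close>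

lemma coclosed_contains_simple_root:
  assumes "A \<subseteq> pos_roots n" "root_coclosed n A" "A \<noteq> {}"
  shows "\<exists>i<n. simple_root i \<in> A"
proof (rule ccontr)
  assume *: "\<not> (\<exists>i<n. simple_root i \<in> A)"
  have succ: "aff_root n c (c + 1) \<notin> A" for c
    using * n2 by (auto simp: aff_root_succ nat_less_iff)
  have "aff_root n a (a + 1 + int k) \<notin> A" for a k
  proof (induction k)
    case (Suc k)
    have "aff_root n (a + 1 + int k) (a + 1 + int (Suc k)) \<notin> A"
      using succ[of "a + 1 + int k"] by (simp add: algebra_simps)
    moreover have "a < a + 1 + int k" "a + 1 + int k < a + 1 + int (Suc k)" by simp_all
    ultimately show ?case using Suc assms(2) unfolding root_coclosed_def by blast
  qed (simp add: succ)
  moreover obtain v where "v \<in> A" using assms(3) by blast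
  then obtain a b where ab: "aff_root n a b \<in> A" "a < b"
    using assms(1) by (auto simp: pos_roots_def)
  moreover have "b = a + 1 + int (nat (b - a - 1))" using ab by simp
  ultimately show False by metis
qed

text \<open>The reflection preserves the order of a triple \<open>a < b < c\<close> except for
  swapped pairs, and a swapped pair represents the simple root itself, which lies in
  \<open>A\<close>.\<close>

lemma biclosed_descent:
  assumes A: "A \<subseteq> pos_roots n" "root_closed n A" "root_coclosed n A"
    and i: "i < n" "simple_root i \<in> A"
  defines "A' \<equiv> simple_refl n i ` (A - {simple_root i})"
  shows "A' \<subseteq> pos_roots n" "root_closed n A'" "root_coclosed n A'"
proof -
  let ?t = "aff_transp n i"
  have mem: "aff_root n a b \<in> A' \<longleftrightarrow>
      aff_root n (?t a) (?t b) \<in> A \<and> aff_root n (?t a) (?t b) \<noteq> simple_root i" for a b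
    using i unfolding A'_def by (simp add: in_simple_refl_image_iff simple_refl_aff_root)
  show A': "A' \<subseteq> pos_roots n"
    using A(1) i simple_refl_in_pos_roots by (auto simp: A'_def)
  have lt: "a < b" if "aff_root n a b \<in> A" for a b
    using that A(1) aff_root_pos_iff by blast
  have long: "aff_root n a c \<noteq> simple_root i" if "a < b" "b < c" for a b c
    using that aff_root_height_eq[of a c "int i" "int i + 1"] i(1) by (auto simp: simple_root_eq)
  have root_neq: "aff_root n (?t a) (?t b) \<noteq> simple_root i" if "a < b" for a b
  proof
    assume "aff_root n (?t a) (?t b) = simple_root i"
    then have "simple_refl n i (simple_root i) = aff_root n a b"
      using i(1) by (metis aff_transp_involution simple_refl_aff_root)
    then show False using simple_refl_simple_root[OF i(1)] that by simp
  qed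
  have rev: "aff_root n (?t b) (?t a) = simple_root i \<and> ?t b < ?t a" if "a < b" "\<not> ?t a < ?t b" for a b
  proof -
    have "?t b < ?t a" using that aff_transp_eq_iff[of i a b] by linarith
    moreover have "aff_root n (?t b) (?t a) = simple_root i"
    proof -
      have "simple_refl n i (aff_root n a b) = simple_refl n i (simple_root i)"
        using aff_transp_reverses[OF i(1) that] by simp
      then have "aff_root n (?t a) (?t b) = aff_root n (int i + 1) (int i)"
        using i(1) by (simp add: simple_refl_aff_root simple_root_eq aff_transp_simple)
      then have "aff_root n (?t b) (?t a) = aff_root n (int i) (int i + 1)"
        by (simp add: aff_root_def fun_eq_iff) (metis minus_diff_eq)
      then show ?thesis using i(1) by (simp add: simple_root_eq)
    qed
    ultimately show ?thesis by simp
  qed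
  show "root_closed n A'"
    unfolding root_closed_def mem
  proof (intro allI impI)
    fix a b c
    assume "aff_root n (?t a) (?t b) \<in> A \<and> aff_root n (?t a) (?t b) \<noteq> simple_root i"
      and "aff_root n (?t b) (?t c) \<in> A \<and> aff_root n (?t b) (?t c) \<noteq> simple_root i"
    then show "aff_root n (?t a) (?t c) \<in> A \<and> aff_root n (?t a) (?t c) \<noteq> simple_root i"
      using A(2) lt long unfolding root_closed_def by blast
  qed
  show "root_coclosed n A'"
    unfolding root_coclosed_def mem
  proof (intro allI impI)
    fix a b c assume ab: "a < b" and bc: "b < c"
      and "aff_root n (?t a) (?t c) \<in> A \<and> aff_root n (?t a) (?t c) \<noteq> simple_root i"
    then have ac: "aff_root n (?t a) (?t c) \<in> A" by simp
    consider "?t a < ?t b" "?t b < ?t c" | "\<not> ?t a < ?t b" | "\<not> ?t b < ?t c" by blast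
    then have "aff_root n (?t a) (?t b) \<in> A \<or> aff_root n (?t b) (?t c) \<in> A"
    proof cases
      case 1
      then show ?thesis using A(3) ac unfolding root_coclosed_def by blast
    next
      case 2
      \<comment> \<open>The pair \<open>(?t b, ?t a)\<close> represents the simple root; closedness
        of \<open>A\<close> joins it to the root of \<open>(?t a, ?t c)\<close>. The next case is
        symmetric.\<close>
      then show ?thesis using rev[OF ab] lt[OF ac] i(2) A(2) ac unfolding root_closed_def by force
    next
      case 3
      then show ?thesis using rev[OF bc] lt[OF ac] i(2) A(2) ac unfolding root_closed_def by force
    qed
    then show "aff_root n (?t a) (?t b) \<in> A \<and> aff_root n (?t a) (?t b) \<noteq> simple_root i \<or>
        aff_root n (?t b) (?t c) \<in> A \<and> aff_root n (?t b) (?t c) \<noteq> simple_root i"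
      using root_neq ab bc by blast
  qed
qed

text \<open>Induction on the cardinality: peel off a simple root, take a word for the reflected rest
  and put \<open>i\<close> back in front. The length of the word later shows that it is
  reduced.\<close>

lemma biclosed_is_inversions:
  assumes "finite A" "A \<subseteq> pos_roots n" "root_closed n A" "root_coclosed n A"
  shows "\<exists>us\<in>lists {..<n}. length us = card A \<and> inversions n us = A"
  using assms
proof (induction "card A" arbitrary: A)
  case 0
  then have "A = {}" by simp
  moreover have "inversions n [] = {}"
    by (auto simp: inversions_def neg_roots_def)
  ultimately show ?case by (intro bexI[of _ "[]"]) auto
next
  case (Suc m)
  then have "A \<noteq> {}" by auto
  then obtain i where i: "i < n" "simple_root i \<in> A"
    using coclosed_contains_simple_root Suc.prems by blast
  define A' where "A' = simple_refl n i ` (A - {simple_root i})"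
  have "card A' = m"
    using Suc.hyps(2) Suc.prems(1) i by (simp add: A'_def card_image inj_simple_refl)
  moreover have "finite A'" using Suc.prems(1) by (simp add: A'_def)
  ultimately obtain us where us: "us \<in> lists {..<n}" "length us = m" "inversions n us = A'"
    using Suc.hyps(1)[of A'] biclosed_descent[OF Suc.prems(2-4) i] unfolding A'_def by blast
  have sr: "simple_root i \<notin> A'"
    using simple_refl_simple_root[OF i(1)] Suc.prems(2)
    by (auto simp: A'_def in_simple_refl_image_iff i(1))
  have "v \<in> inversions n (i # us) \<longleftrightarrow> v \<in> A" for v
  proof (cases "v = simple_root i")
    case True
    then show ?thesis using sr us i inversions_Cons_iff[OF us(1) i(1), of v] by simp
  next
    case False
    have "simple_refl n i v \<noteq> simple_root i" if "v \<in> pos_roots n"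
      using that simple_refl_simple_root[OF i(1)] simple_refl_involution'[OF i(1), of v] by metis
    then have "v \<in> inversions n (i # us) \<longleftrightarrow> v \<in> pos_roots n \<and> v \<in> A"
      using False us i inversions_Cons_iff[OF us(1) i(1), of v]
      by (auto simp: A'_def in_simple_refl_image_iff)
    then show ?thesis using Suc.prems(2) by blast
  qed
  then have "inversions n (i # us) = A" by blast
  with us i Suc.hyps(2) show ?case by (intro bexI[of _ "i # us"]) auto
qed

section \<open>Inversion sets determine the group element\<close>

text \<open>Linearity in coordinates: the values on the simple roots determine a product of
  reflections.\<close>

lemma word_prod_coeffs:
  "us \<in> lists {..<n} \<Longrightarrow> word_prod n us v k =
     (if k < n then \<Sum>j<n. v j * word_prod n us (simple_root j) k else v k)"
proof (induction us arbitrary: k)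
  case Nil
  then show ?case by (simp add: simple_root_def of_bool_def if_distrib cong: if_cong)
next
  case (Cons i us)
  then have i: "i < n" and IH: "\<And>k. word_prod n us v k =
     (if k < n then \<Sum>j<n. v j * word_prod n us (simple_root j) k else v k)" by auto
  let ?W = "\<lambda>j. word_prod n us (simple_root j)"
  show ?case
  proof (cases "k < n")
    case True
    have "(\<Sum>l<n. cartan n i l * word_prod n us v l) = (\<Sum>l<n. \<Sum>j<n. v j * (cartan n i l * ?W j l))"
      by (simp add: IH sum_distrib_left mult.left_commute)
    also have "\<dots> = (\<Sum>j<n. v j * (\<Sum>l<n. cartan n i l * ?W j l))"
      by (subst sum.swap) (simp add: sum_distrib_left)
    finally show ?thesis
      using True
      by (simp add: simple_refl_def IH[of k] right_diff_distrib sum_subtractf sum_distrib_right mult.assoc)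
  next
    case False
    then show ?thesis using i by (simp add: simple_refl_def IH[of k] simple_root_def)
  qed
qed

lemma word_prod_eq_id:
  assumes "us \<in> lists {..<n}" "aff_perm n us = id"
  shows "word_prod n us = id"
proof -
  have "word_prod n us (simple_root j) = word_prod n [] (simple_root j)" if "j < n" for j
    using that assms by (simp add: simple_root_eq word_prod_aff_root)
  then have "word_prod n us v k = word_prod n [] v k" for v k
    using word_prod_coeffs[OF assms(1), of v k] word_prod_coeffs[of "[]" v k]
    by (simp del: word_prod_Nil)
  then show ?thesis by (auto simp: fun_eq_iff)
qed

text \<open>This invariant separates \<open>id\<close> from the nontrivial translations of \<open>\<int>\<close>.\<close>

lemma sum_aff_perm:
  "(\<Sum>c<n. aff_perm n us (int c)) = (\<Sum>c<n. int c)"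
proof (induction us rule: rev_induct)
  case (snoc i us)
  let ?p = "aff_perm n us"
  \<comment> \<open>\<open>h c\<close> is the contribution of the swap of \<open>c\<close> and
    \<open>c + 1\<close>. Appending \<open>i\<close> changes the value at \<open>c\<close> by
    \<open>h c - h (c - 1)\<close>, so the sum over a period telescopes.\<close>
  define h where "h c = of_bool (c mod int n = int i) * (?p (c + 1) - ?p c)" for c
  have "?p (aff_transp n i c) - ?p c = h c - h (c - 1)" for c
    using pred_mod_neq[of c i] by (auto simp: h_def aff_transp_def displacement_def)
  then have "(\<Sum>c<n. ?p (aff_transp n i (int c)) - ?p (int c)) = (\<Sum>c<n. h (int (Suc c) - 1) - h (int c - 1))"
    by simp
  also have "\<dots> = h (int n - 1) - h (-1)"
    using sum_lessThan_telescope[of "\<lambda>c. h (int c - 1)" n] by simp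
  \<comment> \<open>The boundary terms lie one period apart, and the differences of
    \<open>?p\<close> are periodic.\<close>
  also have "h (int n - 1) = h (-1)"
    using aff_perm_translate[of us "-1" 1] aff_perm_translate[of us 0 1]
      mod_add_self1[of "int n" "-1"] by (simp add: h_def)
  finally show ?case using snoc by (simp add: aff_perm_append sum_subtractf)
qed simp

text \<open>An increasing bijection of the integers is a translation, and
  \<open>sum_aff_perm\<close> leaves only the trivial one.\<close>

lemma strict_mono_aff_perm_id:
  assumes mono: "\<And>a b. a < b \<Longrightarrow> aff_perm n us a < aff_perm n us b"
  shows "aff_perm n us = id"
proof -
  let ?p = "aff_perm n us"
  have succ: "?p (c + 1) = ?p c + 1" for c
  proof -
    \<comment> \<open>The preimage of the next value: it lies beyond \<open>c\<close>, so
      monotonicity keeps the value at \<open>c + 1\<close> from overshooting.\<close>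
    define d where "d = aff_perm n (rev us) (?p c + 1)"
    have d: "?p d = ?p c + 1" by (simp add: d_def)
    have "\<not> d \<le> c" using mono[of d c] d by (cases "d = c") auto
    then have "?p (c + 1) \<le> ?p d" using mono[of "c + 1" d] by (cases "d = c + 1") auto
    then show ?thesis using d mono[of c "c + 1"] by simp
  qed
  have shift: "?p c - c = ?p 0" for c
    using int_fun_const[of "\<lambda>c. ?p c - c" c 0] succ by simp
  have "(\<Sum>c<n. ?p (int c) - int c) = 0"
    using sum_aff_perm[of us] by (simp add: sum_subtractf)
  then have "?p 0 = 0" using n2 by (simp add: shift)
  then show ?thesis using shift by (auto simp: fun_eq_iff)
qed

text \<open>With equal inversion sets the two inverse permutations order every pair alike, so
  \<open>rev us @ vs\<close> acts increasingly and hence trivially.\<close>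

lemma inversions_inj:
  assumes us: "us \<in> lists {..<n}" and vs: "vs \<in> lists {..<n}"
    and eq: "inversions n us = inversions n vs"
  shows "word_prod n us = word_prod n vs"
proof -
  have iff: "aff_perm n (rev us) b < aff_perm n (rev us) a \<longleftrightarrow>
      aff_perm n (rev vs) b < aff_perm n (rev vs) a" if "a < b" for a b
    using that aff_root_in_inversions[OF us, of a b] aff_root_in_inversions[OF vs, of a b] eq by simp
  have "aff_perm n (rev us @ vs) a < aff_perm n (rev us @ vs) b" if "a < b" for a b
  proof -
    let ?a = "aff_perm n vs a" and ?b = "aff_perm n vs b"
    have "?a \<noteq> ?b" using that by simp
    then consider "?a < ?b" | "?b < ?a" by linarith
    then have "aff_perm n (rev us) ?a < aff_perm n (rev us) ?b"
    proof cases
      case 1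
      have "aff_perm n (rev us) ?a \<noteq> aff_perm n (rev us) ?b" using that by simp
      moreover have "\<not> aff_perm n (rev us) ?b < aff_perm n (rev us) ?a" using iff[OF 1] that by simp
      ultimately show ?thesis by linarith
    next
      case 2
      then show ?thesis using iff[OF 2] that by simp
    qed
    then show ?thesis by (simp add: aff_perm_append)
  qed
  then have "aff_perm n (rev us @ vs) = id" by (rule strict_mono_aff_perm_id)
  moreover have "rev us @ vs \<in> lists {..<n}" using us vs by (simp add: rev_in_lists)
  ultimately have "word_prod n (rev us @ vs) = id" by (rule word_prod_eq_id[rotated])
  then have "word_prod n (rev us) (word_prod n vs v) = v" for v
    by (simp add: word_prod_append pointfree_idE)
  then have "word_prod n vs v = word_prod n us v" for v
    using word_prod_rev[OF us, of "word_prod n vs v"] by simp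
  then show ?thesis by (simp add: fun_eq_iff)
qed

lemma inversions_cong: "word_prod n us = word_prod n vs \<Longrightarrow> inversions n us = inversions n vs"
  by (simp add: inversions_def)

section \<open>Length and reduced words\<close>

text \<open>Inversion sets are biclosed, so peeling applies to them and yields a word that attains
  the bound \<open>card_inversions_le\<close>.\<close>

lemma ex_word_of_card_inversions:
  assumes "us \<in> lists {..<n}"
  shows "\<exists>vs\<in>lists {..<n}. length vs = card (inversions n us) \<and> word_prod n vs = word_prod n us"
  using biclosed_is_inversions[OF finite_inversions inversions_pos inversions_closed inversions_coclosed,
      OF assms assms assms] inversions_inj[OF _ assms] by blast

lemma weyl_length_word_prod:
  assumes "us \<in> lists {..<n}"
  shows "weyl_length n (word_prod n us) = card (inversions n us)"
  unfolding weyl_length_def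
proof (rule Least_equality)
  show "\<exists>vs\<in>lists {..<n}. word_prod n vs = word_prod n us \<and> length vs = card (inversions n us)"
    using ex_word_of_card_inversions[OF assms] by blast
next
  fix k assume "\<exists>vs\<in>lists {..<n}. word_prod n vs = word_prod n us \<and> length vs = k"
  then show "card (inversions n us) \<le> k"
    using card_inversions_le inversions_cong by metis
qed

text \<open>Whichever reduced word \<open>SOME\<close> picks, its length is the number of
  inversions, so \<open>word_inversions_eq\<close> applies.\<close>

lemma Inv_word_prod:
  assumes us: "us \<in> lists {..<n}"
  shows "Inv n (word_prod n us) = inversions n us"
proof -
  define vs where "vs = (SOME vs. reduced_word n (word_prod n us) vs)"
  have "\<exists>vs. reduced_word n (word_prod n us) vs"
    using ex_word_of_card_inversions[OF us] by (auto simp: reduced_word_def weyl_length_word_prod us)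
  then have "reduced_word n (word_prod n us) vs" unfolding vs_def by (rule someI_ex)
  then have vs: "vs \<in> lists {..<n}" "word_prod n vs = word_prod n us"
      "length vs = card (inversions n us)"
    using us by (simp_all add: reduced_word_def weyl_length_word_prod del: in_lists_conv_set)
  then have "word_inversions n vs = inversions n us"
    using word_inversions_eq inversions_cong by metis
  then show ?thesis by (simp add: Inv_def vs_def)
qed

section \<open>Meets of group elements\<close>

text \<open>Coclosedness says that the complement is transitive. Every lower bound thus avoids the
  transitive closure of the pairs missing from \<open>?I\<close>, and what lies outside that closure
  is itself biclosed.\<close>

lemma ex_word_meet:
  assumes us: "us \<in> lists {..<n}" and vs: "vs \<in> lists {..<n}"
  shows "\<exists>ws\<in>lists {..<n}. inversions n ws \<subseteq> inversions n us \<inter> inversions n vs \<and>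
    (\<forall>zs\<in>lists {..<n}. inversions n zs \<subseteq> inversions n us \<inter> inversions n vs \<longrightarrow>
       inversions n zs \<subseteq> inversions n ws)"
proof -
  let ?I = "inversions n us \<inter> inversions n vs"
  define R where "R = {(a, b). a < b \<and> aff_root n a b \<notin> ?I}"
  define A where "A = {aff_root n a b | a b. a < b \<and> (a, b) \<notin> R\<^sup>+}"
  have lt: "a < b" if "(a, b) \<in> R\<^sup>+" for a b
    using that by (induction rule: trancl_induct) (auto simp: R_def)
  have translate: "(a + int n * m, b + int n * m) \<in> R\<^sup>+" if "(a, b) \<in> R\<^sup>+" for a b m
    using that
  proof (induction rule: trancl_induct)
    case (base b)
    then show ?case by (auto simp: R_def aff_root_translate intro!: r_into_trancl)
  next
    case (step b c)
    then have "(b + int n * m, c + int n * m) \<in> R" by (simp add: R_def aff_root_translate)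
    with step.IH show ?case by (rule trancl_into_trancl)
  qed
  \<comment> \<open>Multiples of the imaginary root are never inversions. Pairs \<open>a < b\<close>
    outside \<open>R\<^sup>+\<close> are therefore incongruent, so \<open>aff_root_eqD\<close>
    applies to them.\<close>
  have imaginary: "(a, b) \<in> R" if less: "a < b" and residue: "a mod int n = b mod int n" for a b
  proof -
    obtain m where b: "b = a + int n * m"
      using mod_eq_imp_translate[OF residue[symmetric]] by blast
    then have "aff_root n a b \<notin> ?I"
      using less by (simp add: aff_root_in_inversions[OF us] aff_perm_translate)
    then show ?thesis using less by (simp add: R_def)
  qed
  \<comment> \<open>A vector fixes its endpoints only up to translation, hence the use of
    \<open>translate\<close>.\<close>
  have mem: "aff_root n a b \<in> A \<longleftrightarrow> a < b \<and> (a, b) \<notin> R\<^sup>+" for a b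
  proof
    assume "aff_root n a b \<in> A"
    then obtain c d where cd: "aff_root n a b = aff_root n c d" "c < d" "(c, d) \<notin> R\<^sup>+"
      by (auto simp: A_def)
    have ab: "a < b" using aff_root_height_eq[OF cd(1)] cd(2) by simp
    have "c mod int n \<noteq> d mod int n" using imaginary[of c d] cd by blast
    then obtain m where "a = c + int n * m" "b = d + int n * m"
      using aff_root_eqD[OF cd(1)[symmetric]] by blast
    then have "c = a + int n * (- m)" "d = b + int n * (- m)" by simp_all
    then have "(a, b) \<notin> R\<^sup>+" using translate[of a b "- m"] cd(3) by metis
    with ab show "a < b \<and> (a, b) \<notin> R\<^sup>+" by blast
  qed (auto simp: A_def)
  have sub: "A \<subseteq> ?I" by (auto simp: A_def R_def)
  have A_pos: "A \<subseteq> pos_roots n" using sub inversions_pos by blast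
  \<comment> \<open>A chain of pairs from \<open>a\<close> to \<open>c\<close> passes
    \<open>b\<close> at a joint or inside one link; closedness of the inversion sets splits that
    link at \<open>b\<close>. This makes \<open>A\<close> closed.\<close>
  have split: "(a, b) \<in> R\<^sup>+ \<or> (b, c) \<in> R\<^sup>+" if "(a, c) \<in> R\<^sup>+" "a < b" "b < c" for a b c
    using that
  proof (induction rule: trancl_induct)
    case (base c)
    have "aff_root n a b \<notin> inversions n us \<or> aff_root n b c \<notin> inversions n us"
      if "aff_root n a c \<notin> inversions n us"
      using that base.prems inversions_closed[OF us] unfolding root_closed_def by blast
    moreover have "aff_root n a b \<notin> inversions n vs \<or> aff_root n b c \<notin> inversions n vs"
      if "aff_root n a c \<notin> inversions n vs"
      using that base.prems inversions_closed[OF vs] unfolding root_closed_def by blast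
    ultimately have "(a, b) \<in> R \<or> (b, c) \<in> R" using base by (auto simp: R_def)
    then show ?case by blast
  next
    case (step c d)
    consider "b < c" | "b = c" | "c < b" by linarith
    then show ?case
    proof cases
      case 1
      then show ?thesis using step trancl_into_trancl[OF _ step.hyps(2)] by blast
    next
      case 2
      then show ?thesis using step by blast
    next
      case 3
      have "aff_root n c b \<notin> inversions n us \<or> aff_root n b d \<notin> inversions n us"
        if "aff_root n c d \<notin> inversions n us"
        using that 3 step.prems inversions_closed[OF us] unfolding root_closed_def by blast
      moreover have "aff_root n c b \<notin> inversions n vs \<or> aff_root n b d \<notin> inversions n vs"
        if "aff_root n c d \<notin> inversions n vs"
        using that 3 step.prems inversions_closed[OF vs] unfolding root_closed_def by blast
      ultimately have "(c, b) \<in> R \<or> (b, d) \<in> R" using 3 step by (auto simp: R_def)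
      then show ?thesis using trancl_into_trancl[OF step.hyps(1)] by blast
    qed
  qed
  have "root_closed n A"
    unfolding root_closed_def mem
  proof (intro allI impI)
    fix a b c assume *: "a < b" "b < c" "a < b \<and> (a, b) \<notin> R\<^sup>+" "b < c \<and> (b, c) \<notin> R\<^sup>+"
    then have "(a, c) \<notin> R\<^sup>+" using split[of a c b] by blast
    then show "a < c \<and> (a, c) \<notin> R\<^sup>+" using *(1,2) by simp
  qed
  moreover have "root_coclosed n A"
    unfolding root_coclosed_def mem
  proof (intro allI impI)
    fix a b c assume *: "a < b" "b < c" "a < c \<and> (a, c) \<notin> R\<^sup>+"
    then have "(a, b) \<notin> R\<^sup>+ \<or> (b, c) \<notin> R\<^sup>+" using trancl_trans[of a b R c] by blast
    then show "a < b \<and> (a, b) \<notin> R\<^sup>+ \<or> b < c \<and> (b, c) \<notin> R\<^sup>+" using *(1,2) by blast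
  qed
  moreover have "finite A"
    using sub finite_inversions[OF us] by (meson finite_subset le_infE)
  ultimately obtain ws where ws: "ws \<in> lists {..<n}" "inversions n ws = A"
    using biclosed_is_inversions A_pos by blast
  have "inversions n zs \<subseteq> A" if zs: "zs \<in> lists {..<n}" "inversions n zs \<subseteq> ?I" for zs
  proof
    fix v assume v: "v \<in> inversions n zs"
    then have "v \<in> pos_roots n" using inversions_pos by blast
    then obtain a b where ab: "v = aff_root n a b" "a < b" by (auto simp: pos_roots_def)
    have "aff_root n c d \<notin> inversions n zs" if "(c, d) \<in> R\<^sup>+" for c d
      using that
    proof (induction rule: trancl_induct)
      case (base d)
      then have "aff_root n c d \<notin> ?I" by (simp add: R_def)
      then show ?case using zs(2) by blast
    next
      case (step d e)
      have cd: "c < d" using step.hyps(1) by (rule lt)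
      have de: "d < e" and "aff_root n d e \<notin> ?I" using step.hyps(2) unfolding R_def by blast+
      then have "aff_root n d e \<notin> inversions n zs" using zs(2) by blast
      with cd de show ?case using step.IH inversions_coclosed[OF zs(1)] unfolding root_coclosed_def by blast
    qed
    then show "v \<in> A" using v ab mem[of a b] by blast
  qed
  then show ?thesis using ws sub by (intro bexI[of _ ws]) blast+
qed

section \<open>Extending and cutting reduced words\<close>

text \<open>The simple root of the first letter of \<open>us\<close> is an inversion of both
  elements. Stripping that letter from both keeps the inclusion, and the induction hypothesis
  supplies the suffix.\<close>

lemma ex_word_extension:
  assumes "us \<in> lists {..<n}" "length us = card (inversions n us)"
    and "vs \<in> lists {..<n}" "inversions n us \<subseteq> inversions n vs"
  shows "\<exists>ws\<in>lists {..<n}. word_prod n (us @ ws) = word_prod n vs \<and>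
    length (us @ ws) = card (inversions n vs)"
  using assms
proof (induction us arbitrary: vs rule: list.induct)
  case Nil
  then show ?case using ex_word_of_card_inversions[of vs] by auto
next
  case (Cons i us)
  have i: "i < n" and us: "us \<in> lists {..<n}" using Cons.prems(1) by auto
  have red: "word_inversions n (i # us) = inversions n (i # us)"
    using word_inversions_eq Cons.prems by blast
  then have root: "simple_root i \<in> inversions n (i # us)"
    by (simp add: word_inversions_Cons flip: red)
  then have root_vs: "simple_root i \<in> inversions n vs" using Cons.prems by blast
  \<comment> \<open>Prepending \<open>i\<close> twice changes nothing, so the descent lemma for
    \<open>i # us\<close> computes the inversions of \<open>us\<close>.\<close>
  have "word_prod n (i # i # us) = word_prod n us" by (simp add: fun_eq_iff i)
  then have inv_us: "inversions n us = simple_refl n i ` (inversions n (i # us) - {simple_root i})"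
    using inversions_Cons_descent[OF Cons.prems(1) i root] inversions_cong by metis
  have inv_vs: "inversions n (i # vs) = simple_refl n i ` (inversions n vs - {simple_root i})"
    by (rule inversions_Cons_descent[OF Cons.prems(3) i root_vs])
  have len: "length us = card (inversions n us)"
    using Cons.prems(2) root finite_inversions[OF Cons.prems(1)]
    by (simp add: inv_us card_image inj_simple_refl i)
  have sub: "inversions n us \<subseteq> inversions n (i # vs)"
    using Cons.prems(4) by (auto simp: inv_us inv_vs)
  have vs: "i # vs \<in> lists {..<n}" using Cons.prems(3) i by simp
  obtain ws where ws: "ws \<in> lists {..<n}" "word_prod n (us @ ws) = word_prod n (i # vs)"
    "length (us @ ws) = card (inversions n (i # vs))"
    using Cons.IH[OF us len vs sub] by blast
  have "word_prod n ((i # us) @ ws) = simple_refl n i \<circ> word_prod n (i # vs)"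
    using ws(2) by simp
  also have "\<dots> = word_prod n vs" by (simp add: fun_eq_iff i)
  finally have "word_prod n ((i # us) @ ws) = word_prod n vs" .
  moreover have "length ((i # us) @ ws) = card (inversions n vs)"
  proof -
    have "card (inversions n vs) > 0"
      using root_vs finite_inversions[OF Cons.prems(3)] card_gt_0_iff by blast
    then show ?thesis
      using ws(3) root_vs finite_inversions[OF Cons.prems(3)]
      by (simp add: inv_vs card_image inj_simple_refl i)
  qed
  ultimately show ?case using ws(1) by blast
qed

text \<open>A shorter word for the prefix would give too short a word for the whole product.\<close>

lemma length_append_reducedD:
  assumes "us @ ws \<in> lists {..<n}" "length (us @ ws) = card (inversions n (us @ ws))"
  shows "length us = card (inversions n us)"
proof -
  have us: "us \<in> lists {..<n}" and ws: "ws \<in> lists {..<n}" using assms(1) by auto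
  obtain vs where vs: "vs \<in> lists {..<n}" "length vs = card (inversions n us)"
    "word_prod n vs = word_prod n us"
    using ex_word_of_card_inversions[OF us] by blast
  have "inversions n (vs @ ws) = inversions n (us @ ws)"
    using vs by (intro inversions_cong) (simp add: word_prod_append)
  then have "length (us @ ws) \<le> length (vs @ ws)"
    using assms(2) card_inversions_le[of "vs @ ws"] vs(1) ws by simp
  then show ?thesis using vs(2) card_inversions_le[OF us] by simp
qed

text \<open>Both words are reduced, so their inversions are those listed by
  \<open>word_inversions\<close>, and a longer word only continues the list.\<close>

lemma inversions_append_reduced:
  assumes "us @ ws \<in> lists {..<n}" "length (us @ ws) = card (inversions n (us @ ws))"
  shows "inversions n us \<subseteq> inversions n (us @ ws)"
proof -
  have us: "us \<in> lists {..<n}" using assms(1) by auto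
  have "word_inversions n us = inversions n us"
    by (rule word_inversions_eq[OF us length_append_reducedD[OF assms]])
  moreover have "word_inversions n (us @ ws) = inversions n (us @ ws)"
    by (rule word_inversions_eq[OF assms])
  moreover have "word_inversions n us \<subseteq> word_inversions n (us @ ws)"
  proof -
    have "word_prod n (take k us) (simple_root (us ! k)) \<in> word_inversions n (us @ ws)"
      if "k < length us" for k
      unfolding word_inversions_def using that
      by (intro image_eqI[of _ _ k]) (simp_all add: nth_append)
    then show ?thesis by (auto simp: word_inversions_def)
  qed
  ultimately show ?thesis by simp
qed

section \<open>Infinite reduced words and limit elements\<close>

lemma infinite_word_prefix:
  assumes "i \<in> reduced_infinite_words n"
  shows "map i [0..<k] \<in> lists {..<n}"
    and "length (map i [0..<k]) = card (inversions n (map i [0..<k]))"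
proof -
  show lists: "map i [0..<k] \<in> lists {..<n}"
    using assms by (force simp: reduced_infinite_words_def)
  have "weyl_length n (word_prod n (map i [0..<k])) = k"
    using assms by (simp add: reduced_infinite_words_def)
  then show "length (map i [0..<k]) = card (inversions n (map i [0..<k]))"
    using weyl_length_word_prod[OF lists] by simp
qed

lemma inversions_prefix_Suc:
  assumes "i \<in> reduced_infinite_words n"
  shows "inversions n (map i [0..<k]) \<subseteq> inversions n (map i [0..<Suc k])"
proof -
  have "map i [0..<Suc k] = map i [0..<k] @ [i k]" by simp
  then show ?thesis
    using inversions_append_reduced[of "map i [0..<k]" "[i k]"] infinite_word_prefix[OF assms, of "Suc k"]
    by (simp only:)
qed

lemma Inv_infinite_eq:
  "i \<in> reduced_infinite_words n \<Longrightarrow> Inv_infinite n i = (\<Union>k. inversions n (map i [0..<k]))"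
  unfolding Inv_infinite_def by (simp only: Inv_word_prod infinite_word_prefix(1))

text \<open>The prefix of length \<open>k\<close> already contributes \<open>k\<close> roots. Hence
  no limit element shares its inversion set with a group element.\<close>

lemma infinite_Inv_infinite:
  assumes "i \<in> reduced_infinite_words n"
  shows "infinite (Inv_infinite n i)"
proof
  assume fin: "finite (Inv_infinite n i)"
  have "k \<le> card (Inv_infinite n i)" for k
    using card_mono[OF fin, of "inversions n (map i [0..<k])"] infinite_word_prefix(2)[OF assms, of k]
    by (auto simp: Inv_infinite_eq[OF assms])
  then show False using not_less_eq_eq by blast
qed

lemma limit_elementE:
  assumes "c \<in> limit_elements n"
  obtains i where "i \<in> reduced_infinite_words n" "c = braid_equiv n `` {i}"
    "inversion_set n (Inr c) = Inv_infinite n i"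
proof -
  obtain i where i: "i \<in> reduced_infinite_words n" "c = braid_equiv n `` {i}"
    using assms unfolding limit_elements_def by (rule quotientE)
  moreover have "inversion_set n (Inr c) = Inv_infinite n i"
    using i by (auto simp: braid_equiv_def)
  ultimately show thesis by (rule that)
qed

text \<open>Finiteness separates the two summands; within them, \<open>inversions_inj\<close> and
  the definition of \<open>braid_equiv\<close> decide.\<close>

lemma inversion_set_inj:
  assumes "x \<in> carrier (limit_weak_order n)" "y \<in> carrier (limit_weak_order n)"
    and eq: "inversion_set n x = inversion_set n y"
  shows "x = y"
proof -
  have fin: "finite (inversion_set n (Inl w))" if "w \<in> affine_weyl n" for w
  proof -
    obtain us where "us \<in> lists {..<n}" "w = word_prod n us"
      using \<open>w \<in> affine_weyl n\<close> unfolding affine_weyl_def by (rule imageE)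
    then show ?thesis using finite_inversions by (simp only: inversion_set.simps Inv_word_prod)
  qed
  have inf: "infinite (inversion_set n (Inr c))" if "c \<in> limit_elements n" for c
    using that infinite_Inv_infinite by (metis limit_elementE)
  have ne: "inversion_set n (Inl w) \<noteq> inversion_set n (Inr c)"
    if "w \<in> affine_weyl n" "c \<in> limit_elements n" for w c
    using fin[OF that(1)] inf[OF that(2)] by metis
  consider (fin) w w' where "x = Inl w" "y = Inl w'" "w \<in> affine_weyl n" "w' \<in> affine_weyl n"
    | (inf) c c' where "x = Inr c" "y = Inr c'" "c \<in> limit_elements n" "c' \<in> limit_elements n"
    using assms ne ne[symmetric] unfolding limit_weak_order_def by (auto simp del: inversion_set.simps)
  then show ?thesis
  proof cases
    case fin
    obtain us vs where w: "us \<in> lists {..<n}" "w = word_prod n us" "vs \<in> lists {..<n}" "w' = word_prod n vs"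
      using fin by (auto simp: affine_weyl_def simp del: in_lists_conv_set)
    then have "inversions n us = inversions n vs"
      using eq fin(1,2) by (simp add: Inv_word_prod del: in_lists_conv_set)
    then show ?thesis using inversions_inj w fin(1,2) by blast
  next
    case inf
    obtain i where i: "i \<in> reduced_infinite_words n" "c = braid_equiv n `` {i}"
      "inversion_set n (Inr c) = Inv_infinite n i" using inf(3) by (rule limit_elementE)
    obtain j where j: "j \<in> reduced_infinite_words n" "c' = braid_equiv n `` {j}"
      "inversion_set n (Inr c') = Inv_infinite n j" using inf(4) by (rule limit_elementE)
    have "Inv_infinite n i = Inv_infinite n j" using eq inf(1,2) i(3) j(3) by simp
    then have "c = c'" using i(1,2) j(1,2) by (auto simp: braid_equiv_def)
    then show ?thesis using inf(1,2) by simp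
  qed
qed

text \<open>Treats both kinds of elements alike: a constant sequence for a group element, the
  prefixes for a limit element.\<close>

lemma ex_word_chain:
  assumes "x \<in> carrier (limit_weak_order n)"
  shows "\<exists>f. (\<forall>k. f k \<in> lists {..<n} \<and> inversions n (f k) \<subseteq> inversions n (f (Suc k))) \<and>
    inversion_set n x = (\<Union>k. inversions n (f k))"
proof -
  consider w where "x = Inl w" "w \<in> affine_weyl n" | c where "x = Inr c" "c \<in> limit_elements n"
    using assms by (auto simp: limit_weak_order_def)
  then show ?thesis
  proof cases
    case 1
    then obtain us where "us \<in> lists {..<n}" "x = Inl (word_prod n us)"
      by (auto simp: affine_weyl_def simp del: in_lists_conv_set)
    then show ?thesis
      by (intro exI[of _ "\<lambda>_. us"]) (simp add: Inv_word_prod del: in_lists_conv_set)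
  next
    case 2
    then obtain i where i: "i \<in> reduced_infinite_words n" "inversion_set n x = Inv_infinite n i"
      by (metis limit_elementE)
    then show ?thesis
      using infinite_word_prefix(1)[OF i(1)] inversions_prefix_Suc[OF i(1)]
      by (intro exI[of _ "\<lambda>k. map i [0..<k]"]) (simp only: Inv_infinite_eq[OF i(1)] simp_thms)
  qed
qed

lemma ex_infinite_word:
  assumes L: "\<And>k. L k \<in> lists {..<n}" "\<And>k. length (L k) = card (inversions n (L k))"
    and prefix: "\<And>k. \<exists>ws. L (Suc k) = L k @ ws"
    and unbounded: "\<And>m. \<exists>k. m < length (L k)"
  shows "\<exists>i\<in>reduced_infinite_words n. Inv_infinite n i = (\<Union>k. inversions n (L k))"
proof -
  have prefix_le: "\<exists>ws. L k = L j @ ws" if "j \<le> k" for j k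
    using that
  proof (induction k rule: dec_induct)
    case (step k)
    then show ?case using prefix[of k] by (metis append.assoc)
  qed simp
  \<comment> \<open>Letter \<open>m\<close> is read off some word long enough to have it;
    \<open>i_nth\<close> shows that the choice does not matter.\<close>
  define i where "i m = L (SOME k. m < length (L k)) ! m" for m
  have i_nth: "i m = L k ! m" if "m < length (L k)" for m k
  proof -
    define j where "j = (SOME k. m < length (L k))"
    have "m < length (L j)" unfolding j_def using unbounded by (rule someI_ex)
    moreover obtain ws where "L k = L j @ ws \<or> L j = L k @ ws"
      using prefix_le[of j k] prefix_le[of k j] by (meson nat_le_linear)
    ultimately show ?thesis using that unfolding i_def j_def[symmetric] by (auto simp: nth_append)
  qed
  have take: "map i [0..<m] = take m (L k)" if "m \<le> length (L k)" for m k
    using that by (intro nth_equalityI) (simp_all add: i_nth)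
  have red: "map i [0..<m] \<in> lists {..<n} \<and> length (map i [0..<m]) = card (inversions n (map i [0..<m])) \<and>
      (\<exists>k. inversions n (map i [0..<m]) \<subseteq> inversions n (L k))" for m
  proof -
    obtain k where "m < length (L k)" using unbounded by blast
    then have eq: "map i [0..<m] = take m (L k)" by (simp add: take)
    have app: "take m (L k) @ drop m (L k) \<in> lists {..<n}"
      "length (take m (L k) @ drop m (L k)) = card (inversions n (take m (L k) @ drop m (L k)))"
      using L by (simp_all only: append_take_drop_id)
    have "inversions n (take m (L k)) \<subseteq> inversions n (L k)"
      using inversions_append_reduced[OF app] by simp
    moreover have "take m (L k) \<in> lists {..<n}" using app(1) unfolding append_in_lists_conv by blast
    ultimately show ?thesis
      unfolding eq using length_append_reducedD[OF app] by blast
  qed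
  have i: "i \<in> reduced_infinite_words n"
  proof -
    have "i m < n" for m
      using red[of "Suc m"] by simp
    moreover have "weyl_length n (word_prod n (map i [0..<m])) = m" for m
      using red[of m] weyl_length_word_prod[of "map i [0..<m]"] by simp
    ultimately show ?thesis by (auto simp: reduced_infinite_words_def)
  qed
  moreover have "(\<Union>m. inversions n (map i [0..<m])) = (\<Union>k. inversions n (L k))"
  proof (intro equalityI subsetI)
    fix v assume "v \<in> (\<Union>m. inversions n (map i [0..<m]))"
    then show "v \<in> (\<Union>k. inversions n (L k))" using red by blast
  next
    fix v assume "v \<in> (\<Union>k. inversions n (L k))"
    then obtain k where "v \<in> inversions n (L k)" by blast
    then have "v \<in> inversions n (map i [0..<length (L k)])" using take[of "length (L k)" k] by simp
    then show "v \<in> (\<Union>m. inversions n (map i [0..<m]))" by blast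
  qed
  ultimately show ?thesis using Inv_infinite_eq by auto
qed

text \<open>Converse of \<open>ex_word_chain\<close>. A finite union is attained at one stage; for
  an infinite one, nested reduced words grow into an infinite word.\<close>

lemma ex_chain_sup:
  assumes f: "\<And>k. f k \<in> lists {..<n}" "\<And>k. inversions n (f k) \<subseteq> inversions n (f (Suc k))"
  shows "\<exists>z\<in>carrier (limit_weak_order n). inversion_set n z = (\<Union>k. inversions n (f k))"
proof -
  let ?U = "\<Union>k. inversions n (f k)"
  have mono: "inversions n (f j) \<subseteq> inversions n (f k)" if "j \<le> k" for j k
    using lift_Suc_mono_le[of "\<lambda>k. inversions n (f k)", OF f(2) that] .
  have bound: "\<exists>k. B \<subseteq> inversions n (f k)" if "finite B" "B \<subseteq> ?U" for B
    using that
  proof (induction B rule: finite_induct)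
    case (insert v B)
    then obtain j k where "B \<subseteq> inversions n (f j)" "v \<in> inversions n (f k)" by blast
    then have "insert v B \<subseteq> inversions n (f (max j k))"
      using mono[of j "max j k"] mono[of k "max j k"] by auto
    then show ?case by blast
  qed simp
  show ?thesis
  proof (cases "finite ?U")
    case True
    then obtain k where "?U = inversions n (f k)" using bound[of ?U] by blast
    moreover have "Inl (word_prod n (f k)) \<in> carrier (limit_weak_order n)"
      using f(1) by (simp add: limit_weak_order_def affine_weyl_def InlI imageI del: in_lists_conv_set)
    ultimately show ?thesis
      using f(1) by (intro bexI[of _ "Inl (word_prod n (f k))"]) (simp_all add: Inv_word_prod del: in_lists_conv_set)
  next
    case False
    let ?P = "\<lambda>k us. us \<in> lists {..<n} \<and> word_prod n us = word_prod n (f k) \<and> length us = card (inversions n (f k))"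
    \<comment> \<open>The words \<open>f k\<close> need neither be reduced nor extend each other, so
      reduced words for the same elements are chosen recursively, with
      \<open>ex_word_extension\<close> as the step.\<close>
    have "\<exists>L. \<forall>k. ?P k (L k) \<and> (\<exists>ws. L (Suc k) = L k @ ws)"
    proof (rule dependent_nat_choice)
      show "\<exists>us. ?P 0 us" using ex_word_of_card_inversions[OF f(1)[of 0]] by blast
    next
      fix us k assume us: "?P k us"
      then have "inversions n us = inversions n (f k)" using inversions_cong by blast
      then have "\<exists>ws\<in>lists {..<n}. word_prod n (us @ ws) = word_prod n (f (Suc k)) \<and>
          length (us @ ws) = card (inversions n (f (Suc k)))"
        using us f by (intro ex_word_extension) auto
      then show "\<exists>vs. ?P (Suc k) vs \<and> (\<exists>ws. vs = us @ ws)"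
        using us by (metis append_in_lists_conv)
    qed
    then obtain L where L: "\<And>k. ?P k (L k)" and prefix: "\<And>k. \<exists>ws. L (Suc k) = L k @ ws" by blast
    have inv: "inversions n (L k) = inversions n (f k)" for k using L inversions_cong by blast
    have "\<exists>k. m < length (L k)" for m
    proof -
      obtain B where B: "finite B" "card B = Suc m" "B \<subseteq> ?U"
        using infinite_arbitrarily_large[OF False] by blast
      then obtain k where "B \<subseteq> inversions n (f k)" using bound by blast
      then have "Suc m \<le> card (inversions n (f k))"
        using card_mono[OF finite_inversions[OF f(1)]] B(2) by metis
      then show ?thesis using L[of k] by (intro exI[of _ k]) simp
    qed
    then obtain i where i: "i \<in> reduced_infinite_words n" "Inv_infinite n i = ?U"
      using ex_infinite_word[of L] L prefix inv by auto
    define c where "c = braid_equiv n `` {i}"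
    have "c \<in> limit_elements n" using i(1) by (simp add: c_def limit_elements_def quotientI)
    moreover have "inversion_set n (Inr c) = ?U"
      using i by (auto simp: c_def braid_equiv_def)
    ultimately show ?thesis
      by (intro bexI[of _ "Inr c"]) (simp_all add: limit_weak_order_def InrI)
  qed
qed

section \<open>Meets in the limit weak order\<close>

lemma ex_meet:
  assumes "x \<in> carrier (limit_weak_order n)" "y \<in> carrier (limit_weak_order n)"
  shows "\<exists>z\<in>carrier (limit_weak_order n). inversion_set n z \<subseteq> inversion_set n x \<inter> inversion_set n y \<and>
    (\<forall>u\<in>carrier (limit_weak_order n). inversion_set n u \<subseteq> inversion_set n x \<inter> inversion_set n y \<longrightarrow>
       inversion_set n u \<subseteq> inversion_set n z)"
proof -
  obtain f where f: "\<And>k. f k \<in> lists {..<n}" "\<And>k. inversions n (f k) \<subseteq> inversions n (f (Suc k))"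
    "inversion_set n x = (\<Union>k. inversions n (f k))" using ex_word_chain[OF assms(1)] by blast
  obtain g where g: "\<And>k. g k \<in> lists {..<n}" "\<And>k. inversions n (g k) \<subseteq> inversions n (g (Suc k))"
    "inversion_set n y = (\<Union>k. inversions n (g k))" using ex_word_chain[OF assms(2)] by blast
  let ?I = "\<lambda>k. inversions n (f k) \<inter> inversions n (g k)"
  have "\<exists>ws. ws \<in> lists {..<n} \<and> inversions n ws \<subseteq> ?I k \<and>
      (\<forall>zs\<in>lists {..<n}. inversions n zs \<subseteq> ?I k \<longrightarrow> inversions n zs \<subseteq> inversions n ws)" for k
    using ex_word_meet[OF f(1) g(1)] by blast
  then obtain h where h: "\<And>k. h k \<in> lists {..<n}" "\<And>k. inversions n (h k) \<subseteq> ?I k"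
    "\<And>k zs. zs \<in> lists {..<n} \<Longrightarrow> inversions n zs \<subseteq> ?I k \<Longrightarrow> inversions n zs \<subseteq> inversions n (h k)"
    by metis
  have mono_f: "inversions n (f j) \<subseteq> inversions n (f k)"
    and mono_g: "inversions n (g j) \<subseteq> inversions n (g k)" if "j \<le> k" for j k
    using lift_Suc_mono_le[of "\<lambda>k. inversions n (f k)", OF f(2) that]
      lift_Suc_mono_le[of "\<lambda>k. inversions n (g k)", OF g(2) that] by blast+
  \<comment> \<open>\<open>h k\<close> is also a lower bound at stage \<open>Suc k\<close>, where
    \<open>h (Suc k)\<close> is the largest one.\<close>
  have "inversions n (h k) \<subseteq> inversions n (h (Suc k))" for k
    using h(2)[of k] f(2)[of k] g(2)[of k] by (intro h(3)[OF h(1)]) blast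
  then obtain z where z: "z \<in> carrier (limit_weak_order n)" "inversion_set n z = (\<Union>k. inversions n (h k))"
    using ex_chain_sup[of h] h(1) by blast
  \<comment> \<open>A finite subset of the intersection of two increasing unions lies in a single
    \<open>?I k\<close>, so a group element below both is below \<open>h k\<close>.\<close>
  have bound: "inversions n us \<subseteq> inversion_set n z"
    if us: "us \<in> lists {..<n}" "inversions n us \<subseteq> inversion_set n x \<inter> inversion_set n y" for us
  proof -
    have "\<exists>k. B \<subseteq> ?I k" if "finite B" "B \<subseteq> inversion_set n x \<inter> inversion_set n y" for B
      using that
    proof (induction B rule: finite_induct)
      case (insert v B)
      then obtain i j k where *: "B \<subseteq> ?I i" "v \<in> inversions n (f j)" "v \<in> inversions n (g k)"
        using f(3) g(3) by auto
      define m where "m = max i (max j k)"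
      have "i \<le> m" "j \<le> m" "k \<le> m" by (simp_all add: m_def)
      then have "insert v B \<subseteq> ?I m"
        using * mono_f[of i m] mono_f[of j m] mono_g[of i m] mono_g[of k m] by blast
      then show ?case by blast
    qed simp
    then obtain k where "inversions n us \<subseteq> ?I k" using finite_inversions us by meson
    then show ?thesis using h(3)[OF us(1)] z(2) by blast
  qed
  \<comment> \<open>The inversion set of \<open>u\<close> may be infinite, but it is a union of
    finite ones covered by \<open>bound\<close>.\<close>
  have "inversion_set n u \<subseteq> inversion_set n z"
    if u: "u \<in> carrier (limit_weak_order n)" "inversion_set n u \<subseteq> inversion_set n x \<inter> inversion_set n y" for u
  proof -
    obtain e :: "nat \<Rightarrow> nat list" where e: "\<And>k. e k \<in> lists {..<n}" "inversion_set n u = (\<Union>k. inversions n (e k))"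
      using ex_word_chain[OF u(1)] by blast
    then have "inversions n (e k) \<subseteq> inversion_set n z" for k using bound u(2) by blast
    then show ?thesis using e(2) by blast
  qed
  moreover have "inversion_set n z \<subseteq> inversion_set n x \<inter> inversion_set n y"
    using z(2) h(2) f(3) g(3) by blast
  ultimately show ?thesis using z(1) by blast
qed

end

theorem theorem4p13:
  fixes n :: nat
  assumes "n \<ge> 2"
  shows "lower_semilattice (limit_weak_order n)"
proof -
  let ?L = "limit_weak_order n"
  have eq: "(.=\<^bsub>?L\<^esub>) = (=)" and le: "x \<sqsubseteq>\<^bsub>?L\<^esub> y \<longleftrightarrow> inversion_set n x \<subseteq> inversion_set n y" for x y
    by (simp_all add: limit_weak_order_def)
  \<comment> \<open>The equivalence of \<open>?L\<close> is equality, so antisymmetry amounts to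
    injectivity of \<open>inversion_set\<close> on the carrier.\<close>
  have "partial_order ?L"
    unfolding partial_order_def weak_partial_order_def equivalence_def
      weak_partial_order_axioms_def partial_order_axioms_def eq le
    using inversion_set_inj[OF assms] by blast
  then interpret partial_order ?L .
  show ?thesis
  proof unfold_locales
    fix x y assume xy: "x \<in> carrier ?L" "y \<in> carrier ?L"
    have Lower: "Lower ?L {x, y} =
        {u \<in> carrier ?L. inversion_set n u \<subseteq> inversion_set n x \<inter> inversion_set n y}"
      using xy unfolding Lower_def le by blast
    show "\<exists>s. greatest ?L s (Lower ?L {x, y})"
      using ex_meet[OF assms xy] unfolding Lower greatest_def le by blast
  qed
qed

end
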